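(* Let $\mathbb{E}=\mathbb{Q}(\zeta_2)$ be a quartic number field of discriminant $\Delta$ and index $f$, where $\zeta_2$ is an algebraic integer with minimal polynomial $g_2(x)\in\mathbb{Z}[x]$. Let $\zeta_1=\sum_{i=1}^{4}u_{i2}\zeta_2^{\,i-1}$, with $u_{12},u_{22},u_{32},u_{42}\in\mathbb{Z}$, be another algebraic integer generating $\mathbb{E}$, with minimal polynomial $g_1(x)$. Then: (1) If there exists $t_2\in\mathbb{Z}$ with $g_2(t_2)\equiv 0\pmod{f^2}$, then there exists $t_1\in\mathbb{Z}$ with $g_1(t_1)\equiv0\pmod{f^2}$. (2) If there exists $t_2\in\mathbb{Z}$ with $g_2(t_2)\equiv0\pmod{f^2}$, $g_2'(t_2)\equiv 0\pmod f$ and $\gcd(m,f)=1$, where $m=u_{22}+2u_{32}t_2+3u_{42}t_2^2$, then there exists $t_1\in\mathbb{Z}$ with $g_1(t_1)\equiv 0\pmod{f^2}$ and $g_1'(t_1)\equiv0\pmod f$.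
   Context: For an algebraic integer $\theta$ generating the number field $\mathbb{E}$, its index is $[\mathcal{O}_{\mathbb{E}}:\mathbb{Z}[\theta]]$, where $\mathcal{O}_{\mathbb{E}}$ is the ring of integers. The index of the field $\mathbb{E}$ is the greatest common divisor of the indices of the algebraic integers generating $\mathbb{E}$. $g'$ denotes the derivative of $g$. *)

theory Defs
  imports
    Complex_Main
    "HOL-Library.FuncSet"
    "HOL-Computational_Algebra.Polynomial"
    "HOL-Number_Theory.Cong"
    "Jordan_Normal_Form.Determinant"
begin

text \<open>
  Number fields are subfields, of finite degree over the rationals, of an arbitrary ambient
  field of characteristic zero given by a type.
\<close>

definition is_subfield :: "'a::field set \<Rightarrow> bool" where
  "is_subfield K \<longleftrightarrow>
     0 \<in> K \<and> 1 \<in> K \<and>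
     (\<forall>x\<in>K. \<forall>y\<in>K. x + y \<in> K \<and> x * y \<in> K) \<and>
     (\<forall>x\<in>K. - x \<in> K \<and> inverse x \<in> K)"

lemma vector_space_of_rat:
  "vector_space (\<lambda>(q::rat) (x::'a::field_char_0). of_rat q * x)"
  by unfold_locales (simp_all add: algebra_simps of_rat_add of_rat_mult)

text \<open>The degree is \<open>0\<close> if the extension is infinite, by the library's convention for \<open>dim\<close>.\<close>

definition rat_degree :: "'a::field_char_0 set \<Rightarrow> nat" where
  "rat_degree K = vector_space.dim (\<lambda>(q::rat) x. of_rat q * x) K"

definition number_field :: "'a::field_char_0 set \<Rightarrow> bool" where
  "number_field K \<longleftrightarrow> is_subfield K \<and> rat_degree K > 0"

definition quartic_number_field :: "'a::field_char_0 set \<Rightarrow> bool" where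
  "quartic_number_field K \<longleftrightarrow> number_field K \<and> rat_degree K = 4"

text \<open>
  In characteristic zero every subfield contains the rationals, so this is the field
  generated by \<open>x\<close> over the rationals.
\<close>

definition rat_adjoin :: "'a::field_char_0 \<Rightarrow> 'a set" where
  "rat_adjoin x = \<Inter> {K. is_subfield K \<and> x \<in> K}"

definition int_adjoin :: "'a::field_char_0 \<Rightarrow> 'a set" where
  "int_adjoin x = {poly (map_poly of_int p) x | p :: int poly. True}"

definition ring_of_integers :: "'a::field_char_0 set \<Rightarrow> 'a set" where
  "ring_of_integers K = {x \<in> K. algebraic_int x}"

definition minimal_polynomial :: "rat poly \<Rightarrow> 'a::field_char_0 \<Rightarrow> bool" where
  "minimal_polynomial p x \<longleftrightarrow>
     lead_coeff p = 1 \<and> poly (map_poly of_rat p) x = 0 \<and>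
     (\<forall>q. q \<noteq> 0 \<and> poly (map_poly of_rat q) x = 0 \<longrightarrow> degree p \<le> degree q)"

text \<open>The number of cosets of \<open>int_adjoin x\<close> in the additive group of \<open>ring_of_integers K\<close>.\<close>

definition element_index :: "'a::field_char_0 set \<Rightarrow> 'a \<Rightarrow> nat" where
  "element_index K x =
     card (ring_of_integers K //
       {(a, b). a \<in> ring_of_integers K \<and> b \<in> ring_of_integers K \<and> a - b \<in> int_adjoin x})"

definition field_index :: "'a::field_char_0 set \<Rightarrow> nat" where
  "field_index K = Gcd {element_index K x | x. algebraic_int x \<and> rat_adjoin x = K}"

text \<open>Embeddings are made extensional, so that distinct elements of this set differ on \<open>K\<close>.\<close>

definition complex_embeddings :: "'a::field_char_0 set \<Rightarrow> ('a \<Rightarrow> complex) set" where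
  "complex_embeddings K =
     {\<sigma> \<in> extensional K. \<sigma> 1 = 1 \<and>
        (\<forall>x\<in>K. \<forall>y\<in>K. \<sigma> (x + y) = \<sigma> x + \<sigma> y \<and> \<sigma> (x * y) = \<sigma> x * \<sigma> y)}"

definition field_trace :: "'a::field_char_0 set \<Rightarrow> 'a \<Rightarrow> complex" where
  "field_trace K x = (\<Sum>\<sigma>\<in>complex_embeddings K. \<sigma> x)"

definition integral_basis :: "'a::field_char_0 set \<Rightarrow> 'a list \<Rightarrow> bool" where
  "integral_basis K bs \<longleftrightarrow>
     set bs \<subseteq> ring_of_integers K \<and>
     (\<forall>x\<in>ring_of_integers K. \<exists>!cs :: int list.
        length cs = length bs \<and> x = (\<Sum>i<length bs. of_int (cs ! i) * bs ! i))"

definition field_discriminant :: "'a::field_char_0 set \<Rightarrow> int" where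
  "field_discriminant K = (THE d. \<exists>bs. integral_basis K bs \<and>
     of_int d = det (mat (length bs) (length bs) (\<lambda>(i, j). field_trace K (bs ! i * bs ! j))))"

end

theory Submission
  imports Defs "Jordan_Normal_Form.Char_Poly"
begin

text \<open>
  Write \<open>\<zeta>\<^sub>1 = U(\<zeta>\<^sub>2)\<close> with \<open>U\<close> an integer polynomial. Since \<open>g\<^sub>1 \<circ> U\<close> vanishes at \<open>\<zeta>\<^sub>2\<close> and \<open>g\<^sub>2\<close>
  is monic, \<open>g\<^sub>1 \<circ> U = g\<^sub>2 h\<close> over the integers. Evaluating this identity and its derivative at
  \<open>t\<^sub>2\<close> shows that \<open>t\<^sub>1 = U(t\<^sub>2)\<close> works in both parts, where \<open>m = U'(t\<^sub>2)\<close> is cancelled in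
  the second.
\<close>

text \<open>\<open>minimal_polynomial\<close> evaluates rational polynomials; this lets integer ones
  be evaluated in the ambient field directly.\<close>

lemma map_poly_of_rat_of_int:
  "map_poly of_rat (map_poly of_int p) = (map_poly of_int p :: 'a::field_char_0 poly)"
  by (rule poly_eqI) (simp add: coeff_map_poly)

text \<open>Because \<open>g\<close> is monic, division by it stays within the integers, and
  minimality of the degree forces the remainder, which also vanishes at \<open>x\<close>, to be
  zero.\<close>

lemma minimal_polynomial_dvd_int_poly:
  fixes x :: "'a::field_char_0" and g p :: "int poly"
  assumes min: "minimal_polynomial (map_poly of_int g) x"
    and root: "poly (map_poly of_int p) x = 0"
  shows "g dvd p"
proof -
  have deg: "degree (map_poly of_int h :: rat poly) = degree h" for h :: "int poly"
    by (rule degree_map_poly) simp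
  have monic: "lead_coeff g = 1"
    using min by (simp add: minimal_polynomial_def deg coeff_map_poly)
  have gx: "poly (map_poly of_int g) x = 0"
    using min by (simp add: minimal_polynomial_def map_poly_of_rat_of_int)
  obtain q r where qr: "pseudo_divmod p g = (q, r)"
    by fastforce
  have "g \<noteq> 0"
    using monic by auto
  \<comment> \<open>Pseudo-division multiplies \<open>p\<close> by a power of the leading
    coefficient of \<open>g\<close>, which is 1 here, so it is genuine division with
    remainder.\<close>
  with pseudo_divmod[OF _ qr] monic
  have p: "p = g * q + r" and r: "r = 0 \<or> degree r < degree g"
    by auto
  have "poly (map_poly of_int r) x = 0"
    using root gx unfolding p by (simp add: of_int_poly_hom.hom_add of_int_poly_hom.hom_mult)
  \<comment> \<open>Minimality ranges over rational polynomials, so it is applied to the rational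
    image of \<open>r\<close>.\<close>
  then have "map_poly of_int r \<noteq> (0 :: rat poly) \<Longrightarrow> degree g \<le> degree r"
    using min unfolding minimal_polynomial_def by (metis deg map_poly_of_rat_of_int)
  with r have "map_poly of_int r = (0 :: rat poly)"
    using not_le by auto
  then have "r = 0"
    by simp
  with p show ?thesis
    by simp
qed

lemma minimal_polynomial_dvd_pcompose:
  fixes x :: "'a::field_char_0" and g\<^sub>1 g\<^sub>2 U :: "int poly"
  assumes "minimal_polynomial (map_poly of_int g\<^sub>2) x"
    and "minimal_polynomial (map_poly of_int g\<^sub>1) (poly (map_poly of_int U) x)"
  shows "g\<^sub>2 dvd pcompose g\<^sub>1 U"
proof (rule minimal_polynomial_dvd_int_poly[OF assms(1)])
  show "poly (map_poly of_int (pcompose g\<^sub>1 U)) x = 0"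
    using assms(2)
    by (simp add: minimal_polynomial_def map_poly_of_rat_of_int of_int_hom.map_poly_pcompose
        poly_pcompose)
qed

theorem theorem3p3:
  fixes E :: "'a::field_char_0 set"
    and \<zeta>\<^sub>1 \<zeta>\<^sub>2 :: 'a
    and g\<^sub>1 g\<^sub>2 :: "int poly"
    and u :: "nat \<Rightarrow> int"
    and \<Delta> :: int
    and f :: nat
  assumes "quartic_number_field E"
    and "\<Delta> = field_discriminant E"
    and "f = field_index E"
    and "algebraic_int \<zeta>\<^sub>2" and "E = rat_adjoin \<zeta>\<^sub>2"
    and "minimal_polynomial (map_poly of_int g\<^sub>2) \<zeta>\<^sub>2"
    and "\<zeta>\<^sub>1 = (\<Sum>i=1..4. of_int (u i) * \<zeta>\<^sub>2 ^ (i - 1))"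
    and "algebraic_int \<zeta>\<^sub>1" and "E = rat_adjoin \<zeta>\<^sub>1"
    and "minimal_polynomial (map_poly of_int g\<^sub>1) \<zeta>\<^sub>1"
  shows "((\<exists>t\<^sub>2::int. [poly g\<^sub>2 t\<^sub>2 = 0] (mod (int f)\<^sup>2)) \<longrightarrow>
            (\<exists>t\<^sub>1::int. [poly g\<^sub>1 t\<^sub>1 = 0] (mod (int f)\<^sup>2))) \<and>
         ((\<exists>t\<^sub>2::int. [poly g\<^sub>2 t\<^sub>2 = 0] (mod (int f)\<^sup>2) \<and>
             [poly (pderiv g\<^sub>2) t\<^sub>2 = 0] (mod int f) \<and>
             gcd (u 2 + 2 * u 3 * t\<^sub>2 + 3 * u 4 * t\<^sub>2\<^sup>2) (int f) = 1) \<longrightarrow>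
            (\<exists>t\<^sub>1::int. [poly g\<^sub>1 t\<^sub>1 = 0] (mod (int f)\<^sup>2) \<and>
             [poly (pderiv g\<^sub>1) t\<^sub>1 = 0] (mod int f)))"
proof -
  \<comment> \<open>The given sum starts at 1, so \<open>u i\<close> is the coefficient of degree
    \<open>i - 1\<close>.\<close>
  define U where "U = [:u 1, u 2, u 3, u 4:]"
  have "\<zeta>\<^sub>1 = poly (map_poly of_int U) \<zeta>\<^sub>2"
    using assms(7) by (simp add: U_def of_int_hom.map_poly_pCons_hom numeral_eq_Suc algebra_simps)
  then have "g\<^sub>2 dvd pcompose g\<^sub>1 U"
    using minimal_polynomial_dvd_pcompose assms(6,10) by blast
  then obtain h where h: "pcompose g\<^sub>1 U = g\<^sub>2 * h" ..
  have eval_comp: "poly g\<^sub>1 (poly U t) = poly g\<^sub>2 t * poly h t" for t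
    using arg_cong[OF h, of "\<lambda>p. poly p t"] by (simp add: poly_pcompose)
  have deriv_comp: "poly (pderiv g\<^sub>1) (poly U t) * poly (pderiv U) t =
      poly g\<^sub>2 t * poly (pderiv h) t + poly h t * poly (pderiv g\<^sub>2) t" for t
    using arg_cong[OF h, of "\<lambda>p. poly (pderiv p) t"]
    by (simp add: pderiv_pcompose pderiv_mult poly_pcompose)
  have slope: "poly (pderiv U) t = u 2 + 2 * u 3 * t + 3 * u 4 * t\<^sup>2" for t
    by (simp add: U_def pderiv_pCons algebra_simps power2_eq_square)
  have root: "[poly g\<^sub>1 (poly U t) = 0] (mod (int f)\<^sup>2)"
    if "[poly g\<^sub>2 t = 0] (mod (int f)\<^sup>2)" for t
    using that by (simp add: eval_comp cong_0_iff)
  have deriv_root: "[poly (pderiv g\<^sub>1) (poly U t) = 0] (mod int f)"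
    if g: "[poly g\<^sub>2 t = 0] (mod (int f)\<^sup>2)" and g': "[poly (pderiv g\<^sub>2) t = 0] (mod int f)"
      and m: "gcd (u 2 + 2 * u 3 * t + 3 * u 4 * t\<^sup>2) (int f) = 1" for t
  proof -
    have "int f dvd poly g\<^sub>2 t"
      using g by (metis cong_0_iff dvd_mult_left power2_eq_square)
    \<comment> \<open>By \<open>deriv_comp\<close> the product is a sum of two terms, one with the
      factor \<open>poly g\<^sub>2 t\<close> and one with \<open>poly (pderiv g\<^sub>2) t\<close>,
      both divisible by \<open>f\<close>.\<close>
    then have "int f dvd poly (pderiv g\<^sub>1) (poly U t) * poly (pderiv U) t"
      using g' by (simp add: deriv_comp cong_0_iff)
    \<comment> \<open>The gcd hypothesis makes the chain-rule factor a unit modulo \<open>f\<close>,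
      so it can be cancelled.\<close>
    moreover have "coprime (int f) (poly (pderiv U) t)"
      using m unfolding slope by (metis coprime_commute coprime_iff_gcd_eq_1)
    ultimately show ?thesis
      by (simp add: cong_0_iff coprime_dvd_mult_left_iff)
  qed
  show ?thesis
    using root deriv_root by (intro conjI impI; elim exE conjE) metis+
qed

end
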